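(* Let $\mathcal F=\{f_1,\dots,f_m\}$ be an iterated function system with compact dynamics on a metrizable space $X$ (not necessarily separable or locally compact), and assume that its global attractor $\mathcal G_{\mathcal F}$ has a compact neighborhood in $X$. Let $d$ be a metric compatible with the topology of $X$, used to define chains, and let $\mathcal F|_{\mathcal G_{\mathcal F}}=\{f_1|_{\mathcal G_{\mathcal F}},\dots,f_m|_{\mathcal G_{\mathcal F}}\}$ be the restricted IFS on $\mathcal G_{\mathcal F}$. Then $$\mathcal C_{\mathcal F}\cap(\mathcal G_{\mathcal F}\times\mathcal G_{\mathcal F})=\mathcal C_{\mathcal F|_{\mathcal G_{\mathcal F}}}.$$ In particular, the chain-recurrent set, the chain nodes and the chain graph of $\mathcal F$ coincide with those of $\mathcal F|_{\mathcal G_{\mathcal F}}$, and likewise the orbitwise chain-recurrent set, the orbitwise chain nodes and the orbitwise chain graph of $\mathcal F$ coincide with those of $\mathcal F|_{\mathcal G_{\mathcal F}}$.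
   Context: An iterated function system (IFS) on $X$ is a finite collection $\mathcal F=\{f_1,\dots,f_m\}$, $m\ge1$, of continuous maps $X\to X$. $\mathcal I^m$ is the set of all finite words in the letters $1,\dots,m$ (including the empty word $0$); $|I|$ is the length of $I$. For $I=i_1\cdots i_k$, $\Phi^I_{\mathcal F}=f_{i_k}\circ\dots\circ f_{i_1}$, and $\Phi^0_{\mathcal F}=\mathrm{id}_X$. $H_{\mathcal F}(A)=\bigcup_{i=1}^m f_i(A)$; $A$ is $H$-invariant if $H_{\mathcal F}(A)=A$. The orbit of $x$ is $\mathcal O_{\mathcal F}(x)=\{\Phi^I_{\mathcal F}(x): I\in\mathcal I^m\}$. $N_\varepsilon(A)=\{x:d(x,A)<\varepsilon\}$. $A$ attracts $K$ if for every $\varepsilon>0$ there is $\tau>0$ with $\Phi^I_{\mathcal F}(K)\subset N_\varepsilon(A)$ for every $|I|\ge\tau$. A global attractor is a compact $H$-invariant set that attracts every compact subset of $X$; it is unique if it exists and is denoted $\mathcal G_{\mathcal F}$. $\mathcal F$ has compact dynamics if it has a global attractor. A compact neighborhood of $\mathcal G_{\mathcal F}$ is a compact set $K\subset X$ whose interior contains $\mathcal G_{\mathcal F}$. Chains: an $\varepsilon$-chain from $x$ to $y$ is a finite sequence $x_0=x,x_1,\dots,x_k=y$ ($k\ge0$) in $X$ with indices $i_0,\dots,i_{k-1}$ such that $d(f_{i_n}(x_n),x_{n+1})<\varepsilon$ for $n=0,\dots,k-1$. $\mathcal C_{\mathcal F}=\{(x,y):$ for every $\varepsilon>0$ there is an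 $\varepsilon$-chain from $x$ to $y\}$ (for the restricted IFS, all points of the chain lie in $\mathcal G_{\mathcal F}$ and the restricted metric is used). Write $x\succcurlyeq y$ for $(x,y)\in\mathcal C_{\mathcal F}$; $x,y$ are chain-equivalent if $x\succcurlyeq y$ and $y\succcurlyeq x$. A point $x$ is chain-recurrent if it is chain-equivalent to $f_i(x)$ for some $i$; it is orbitwise chain-recurrent if it is chain-equivalent to every point of $\mathcal O_{\mathcal F}(x)$. Chain nodes (resp. orbitwise chain nodes) are the chain-equivalence classes of the set of chain-recurrent (resp. orbitwise chain-recurrent) points. The chain graph (resp. orbitwise chain graph) has these as vertices, with an edge from $N_1$ to $N_2\ne N_1$ when $x\succcurlyeq y$ for some $x\in N_1,y\in N_2$. *)

theory Defs
  imports "HOL-Analysis.Analysis"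
begin

text \<open>
  A system is given by its space \<open>X\<close> (a set in a metric space, with the restricted metric),
  the number \<open>m\<close> of maps, and the maps \<open>f 1, \<dots>, f m\<close>; values of \<open>f i\<close> for other indices, or
  outside \<open>X\<close>, are irrelevant. With an explicit carrier, the system on \<open>X\<close> and its restriction
  to an invariant subset are instances of the same notions.
\<close>

definition ifs :: "'a::metric_space set \<Rightarrow> nat \<Rightarrow> (nat \<Rightarrow> 'a \<Rightarrow> 'a) \<Rightarrow> bool" where
  "ifs X m f \<longleftrightarrow> 1 \<le> m \<and> (\<forall>i\<in>{1..m}. continuous_on X (f i) \<and> f i ` X \<subseteq> X)"

definition ifs_restrict :: "'a set \<Rightarrow> (nat \<Rightarrow> 'a \<Rightarrow> 'a) \<Rightarrow> nat \<Rightarrow> 'a \<Rightarrow> 'a" where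
  "ifs_restrict S f = (\<lambda>i. restrict (f i) S)"

definition ifs_words :: "nat \<Rightarrow> nat list set" where
  "ifs_words m = lists {1..m}"

text \<open>\<open>fold\<close> applies the head of the list first: \<open>word_map f [i\<^sub>1, \<dots>, i\<^sub>k] = f i\<^sub>k \<circ> \<dots> \<circ> f i\<^sub>1\<close>.\<close>

definition word_map :: "(nat \<Rightarrow> 'a \<Rightarrow> 'a) \<Rightarrow> nat list \<Rightarrow> 'a \<Rightarrow> 'a" where
  "word_map f I = fold f I"

definition hutchinson :: "nat \<Rightarrow> (nat \<Rightarrow> 'a \<Rightarrow> 'a) \<Rightarrow> 'a set \<Rightarrow> 'a set" where
  "hutchinson m f A = (\<Union>i\<in>{1..m}. f i ` A)"

definition ifs_orbit :: "nat \<Rightarrow> (nat \<Rightarrow> 'a \<Rightarrow> 'a) \<Rightarrow> 'a \<Rightarrow> 'a set" where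
  "ifs_orbit m f x = (\<lambda>I. word_map f I x) ` ifs_words m"

text \<open>
  The condition \<open>A \<noteq> {}\<close> is needed because \<open>infdist x {} = 0\<close> in the library, whereas the
  distance to the empty set should be infinite.
\<close>

definition eps_nbhd :: "'a::metric_space set \<Rightarrow> real \<Rightarrow> 'a set \<Rightarrow> 'a set" where
  "eps_nbhd X \<epsilon> A = {x \<in> X. A \<noteq> {} \<and> infdist x A < \<epsilon>}"

definition attracts ::
    "'a::metric_space set \<Rightarrow> nat \<Rightarrow> (nat \<Rightarrow> 'a \<Rightarrow> 'a) \<Rightarrow> 'a set \<Rightarrow> 'a set \<Rightarrow> bool" where
  "attracts X m f A K \<longleftrightarrow>
     (\<forall>\<epsilon>>0. \<exists>\<tau>>0. \<forall>I\<in>ifs_words m. length I \<ge> \<tau> \<longrightarrow> word_map f I ` K \<subseteq> eps_nbhd X \<epsilon> A)"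

definition global_attractor ::
    "'a::metric_space set \<Rightarrow> nat \<Rightarrow> (nat \<Rightarrow> 'a \<Rightarrow> 'a) \<Rightarrow> 'a set \<Rightarrow> bool" where
  "global_attractor X m f G \<longleftrightarrow>
     G \<subseteq> X \<and> compact G \<and> hutchinson m f G = G \<and>
     (\<forall>K. K \<subseteq> X \<and> compact K \<longrightarrow> attracts X m f G K)"

text \<open>The interior is taken in \<open>X\<close>.\<close>

definition compact_nbhd :: "'a::metric_space set \<Rightarrow> 'a set \<Rightarrow> 'a set \<Rightarrow> bool" where
  "compact_nbhd X A K \<longleftrightarrow> K \<subseteq> X \<and> compact K \<and> A \<subseteq> (top_of_set X) interior_of K"

text \<open>The points of a chain are \<open>p 0, \<dots>, p k\<close> and its indices are \<open>i 0, \<dots>, i (k - 1)\<close>.\<close>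

definition eps_chain ::
    "'a::metric_space set \<Rightarrow> nat \<Rightarrow> (nat \<Rightarrow> 'a \<Rightarrow> 'a) \<Rightarrow> real \<Rightarrow> 'a \<Rightarrow> 'a \<Rightarrow> bool" where
  "eps_chain X m f \<epsilon> x y \<longleftrightarrow>
     (\<exists>(k::nat) (p::nat \<Rightarrow> 'a) (i::nat \<Rightarrow> nat).
        p 0 = x \<and> p k = y \<and> (\<forall>n\<le>k. p n \<in> X) \<and>
        (\<forall>n<k. i n \<in> {1..m} \<and> dist (f (i n) (p n)) (p (Suc n)) < \<epsilon>))"

definition chain_relation ::
    "'a::metric_space set \<Rightarrow> nat \<Rightarrow> (nat \<Rightarrow> 'a \<Rightarrow> 'a) \<Rightarrow> ('a \<times> 'a) set" where
  "chain_relation X m f = {(x, y). \<forall>\<epsilon>>0. eps_chain X m f \<epsilon> x y}"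

definition chain_equivalent ::
    "'a::metric_space set \<Rightarrow> nat \<Rightarrow> (nat \<Rightarrow> 'a \<Rightarrow> 'a) \<Rightarrow> 'a \<Rightarrow> 'a \<Rightarrow> bool" where
  "chain_equivalent X m f x y \<longleftrightarrow>
     (x, y) \<in> chain_relation X m f \<and> (y, x) \<in> chain_relation X m f"

definition chain_recurrent_set ::
    "'a::metric_space set \<Rightarrow> nat \<Rightarrow> (nat \<Rightarrow> 'a \<Rightarrow> 'a) \<Rightarrow> 'a set" where
  "chain_recurrent_set X m f = {x \<in> X. \<exists>i\<in>{1..m}. chain_equivalent X m f x (f i x)}"

definition orbitwise_chain_recurrent_set ::
    "'a::metric_space set \<Rightarrow> nat \<Rightarrow> (nat \<Rightarrow> 'a \<Rightarrow> 'a) \<Rightarrow> 'a set" where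
  "orbitwise_chain_recurrent_set X m f = {x \<in> X. \<forall>y\<in>ifs_orbit m f x. chain_equivalent X m f x y}"

definition chain_classes ::
    "'a::metric_space set \<Rightarrow> nat \<Rightarrow> (nat \<Rightarrow> 'a \<Rightarrow> 'a) \<Rightarrow> 'a set \<Rightarrow> 'a set set" where
  "chain_classes X m f R = R // {(x, y). x \<in> R \<and> y \<in> R \<and> chain_equivalent X m f x y}"

definition chain_nodes ::
    "'a::metric_space set \<Rightarrow> nat \<Rightarrow> (nat \<Rightarrow> 'a \<Rightarrow> 'a) \<Rightarrow> 'a set set" where
  "chain_nodes X m f = chain_classes X m f (chain_recurrent_set X m f)"

definition orbitwise_chain_nodes ::
    "'a::metric_space set \<Rightarrow> nat \<Rightarrow> (nat \<Rightarrow> 'a \<Rightarrow> 'a) \<Rightarrow> 'a set set" where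
  "orbitwise_chain_nodes X m f = chain_classes X m f (orbitwise_chain_recurrent_set X m f)"

definition chain_edges ::
    "'a::metric_space set \<Rightarrow> nat \<Rightarrow> (nat \<Rightarrow> 'a \<Rightarrow> 'a) \<Rightarrow> 'a set set \<Rightarrow> ('a set \<times> 'a set) set" where
  "chain_edges X m f V =
     {(N\<^sub>1, N\<^sub>2). N\<^sub>1 \<in> V \<and> N\<^sub>2 \<in> V \<and> N\<^sub>2 \<noteq> N\<^sub>1 \<and>
        (\<exists>x\<in>N\<^sub>1. \<exists>y\<in>N\<^sub>2. (x, y) \<in> chain_relation X m f)}"

text \<open>Directed graphs are pairs of a vertex set and an edge set.\<close>

definition chain_graph ::
    "'a::metric_space set \<Rightarrow> nat \<Rightarrow> (nat \<Rightarrow> 'a \<Rightarrow> 'a) \<Rightarrow> 'a set set \<times> ('a set \<times> 'a set) set" where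
  "chain_graph X m f = (chain_nodes X m f, chain_edges X m f (chain_nodes X m f))"

definition orbitwise_chain_graph ::
    "'a::metric_space set \<Rightarrow> nat \<Rightarrow> (nat \<Rightarrow> 'a \<Rightarrow> 'a) \<Rightarrow> 'a set set \<times> ('a set \<times> 'a set) set" where
  "orbitwise_chain_graph X m f =
     (orbitwise_chain_nodes X m f, chain_edges X m f (orbitwise_chain_nodes X m f))"

lemma ifs_ifs_restrict:
  assumes "ifs X m f" and "S \<subseteq> X" and "hutchinson m f S = S"
  shows "ifs S m (ifs_restrict S f)"
proof -
  have "f i ` S \<subseteq> S" if "i \<in> {1..m}" for i
    using assms(3) that unfolding hutchinson_def by blast
  moreover have "continuous_on S (restrict (f i) S)" if "i \<in> {1..m}" for i
  proof -
    have "continuous_on S (f i)"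
      using assms(1,2) that unfolding ifs_def by (blast intro: continuous_on_subset)
    then show ?thesis
      by (simp cong: continuous_on_cong)
  qed
  ultimately show ?thesis
    using assms(1) by (auto simp: ifs_def ifs_restrict_def)
qed

end

theory Submission
  imports Defs
begin

text \<open>
  On a finite time horizon, \<open>\<epsilon>\<close>-chains starting in a compact set \<open>C\<close> follow true orbits, uniformly
  in the starting point. Since \<open>G\<close> attracts \<open>C\<close>, a chain from \<open>C\<close> is close to \<open>G\<close> at all times
  between some \<open>\<tau>\<close> and \<open>2\<tau>\<close>. If \<open>C\<close> contains a compact neighbourhood of \<open>G\<close>, the chain can be
  restarted at time \<open>\<tau>\<close>, so that it is close to \<open>G\<close> at all times after \<open>\<tau>\<close>. This gives both halves of
  the theorem: a chain-recurrent point lies on arbitrarily long closed chains, hence in \<open>G\<close>, and a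
  chain between points of \<open>G\<close> stays close to \<open>G\<close>, so that its points can be moved into \<open>G\<close>.
\<close>

section \<open>Chains as paths of a step relation\<close>

text \<open>Treating one jump as a relation turns chains into its reflexive transitive closure and
  chains with n steps into its n-th relational power, so that cutting, joining and repeating chains
  becomes relation algebra.\<close>

definition chain_step ::
    "'a::metric_space set \<Rightarrow> nat \<Rightarrow> (nat \<Rightarrow> 'a \<Rightarrow> 'a) \<Rightarrow> real \<Rightarrow> ('a \<times> 'a) set" where
  "chain_step X m f \<epsilon> = {(x, y). x \<in> X \<and> y \<in> X \<and> (\<exists>i\<in>{1..m}. dist (f i x) y < \<epsilon>)}"

lemma chain_step_mono: "\<epsilon> \<le> \<epsilon>' \<Longrightarrow> chain_step X m f \<epsilon> \<subseteq> chain_step X m f \<epsilon>'"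
  by (force simp: chain_step_def)

lemma relpow_mono_set:
  fixes R S :: "('a \<times> 'a) set"
  shows "R \<subseteq> S \<Longrightarrow> R ^^ n \<subseteq> S ^^ n"
  by (induction n) auto

text \<open>The conjunct \<open>x \<in> X\<close> accounts for the chain with k = 0: the closure is
  reflexive on the whole type, while a chain must have its single point in \<open>X\<close>.\<close>

lemma eps_chain_iff_rtrancl:
  "eps_chain X m f \<epsilon> x y \<longleftrightarrow> x \<in> X \<and> (x, y) \<in> (chain_step X m f \<epsilon>)\<^sup>*"
proof
  assume "eps_chain X m f \<epsilon> x y"
  then obtain k p i where *: "p 0 = x" "p k = y" "\<forall>n\<le>k. p n \<in> X"
      "\<forall>n<k. i n \<in> {1..m} \<and> dist (f (i n) (p n)) (p (Suc n)) < \<epsilon>"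
    unfolding eps_chain_def by blast
  have "(p n, p (Suc n)) \<in> chain_step X m f \<epsilon>" if "n < k" for n
    using * that by (auto simp: chain_step_def)
  then have "(x, y) \<in> chain_step X m f \<epsilon> ^^ k"
    using *(1,2) unfolding relpow_fun_conv by blast
  then have "(x, y) \<in> (chain_step X m f \<epsilon>)\<^sup>*"
    by (rule relpow_imp_rtrancl)
  moreover have "x \<in> X" using *(1,3) by blast
  ultimately show "x \<in> X \<and> (x, y) \<in> (chain_step X m f \<epsilon>)\<^sup>*" by blast
next
  assume *: "x \<in> X \<and> (x, y) \<in> (chain_step X m f \<epsilon>)\<^sup>*"
  then obtain k where "(x, y) \<in> chain_step X m f \<epsilon> ^^ k"
    using rtrancl_imp_relpow by blast
  then obtain p where p: "p 0 = x" "p k = y"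
      "\<forall>n<k. (p n, p (Suc n)) \<in> chain_step X m f \<epsilon>"
    unfolding relpow_fun_conv by blast
  then have "\<forall>n. \<exists>i. n < k \<longrightarrow> i \<in> {1..m} \<and> dist (f i (p n)) (p (Suc n)) < \<epsilon>"
    unfolding chain_step_def by blast
  then obtain i where i: "\<forall>n<k. i n \<in> {1..m} \<and> dist (f (i n) (p n)) (p (Suc n)) < \<epsilon>"
    by metis
  have "p n \<in> X" if "n \<le> k" for n
    using that p * by (cases n) (auto simp: chain_step_def)
  with p i show "eps_chain X m f \<epsilon> x y"
    unfolding eps_chain_def by blast
qed

lemma chain_relation_iff:
  "(x, y) \<in> chain_relation X m f \<longleftrightarrow> x \<in> X \<and> (\<forall>\<epsilon>>0. (x, y) \<in> (chain_step X m f \<epsilon>)\<^sup>*)"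
  by (auto simp: chain_relation_def eps_chain_iff_rtrancl dest: spec[of _ 1])

section \<open>Uniform estimates at compact sets\<close>

lemma finite_common_bound:
  fixes P :: "'i \<Rightarrow> real \<Rightarrow> bool"
  assumes "finite A" and ex: "\<And>a. a \<in> A \<Longrightarrow> \<exists>e>0. P a e"
    and anti: "\<And>a e e'. P a e \<Longrightarrow> e' \<le> e \<Longrightarrow> P a e'"
  shows "\<exists>e>0. \<forall>a\<in>A. P a e"
proof -
  obtain r where r: "\<And>a. a \<in> A \<Longrightarrow> r a > 0 \<and> P a (r a)"
    using ex by metis
  \<comment> \<open>The inserted 1 gives the minimum a value also when \<open>A\<close> is
    empty.\<close>
  let ?e = "Min (insert 1 (r ` A))"
  have "?e > 0"
    using r \<open>finite A\<close> by (subst Min_gr_iff) auto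
  moreover have "P a ?e" if "a \<in> A" for a
    using r[OF that] anti \<open>finite A\<close> that by (meson Min_le finite_imageI finite_insert imageI insertI2)
  ultimately show ?thesis by blast
qed

text \<open>Stronger than uniform continuity on \<open>C\<close>: only \<open>q\<close> lies in
  \<open>C\<close>, while \<open>p\<close> may be any point of \<open>X\<close>, as chain points
  need not stay in a compact set. The radius is a Lebesgue number for the cover of \<open>C\<close>
  by open sets on which \<open>f\<close> oscillates by less than \<theta>.\<close>

lemma continuous_on_uniform_at_compact:
  fixes f :: "'a::metric_space \<Rightarrow> 'b::metric_space"
  assumes cont: "continuous_on X f" and "compact C" "C \<subseteq> X" and "\<theta> > 0"
  shows "\<exists>\<gamma>>0. \<forall>q\<in>C. \<forall>p\<in>X. dist q p < \<gamma> \<longrightarrow> dist (f q) (f p) < \<theta>"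
proof -
  let ?U = "{U. open U \<and> (\<forall>p\<in>U \<inter> X. \<forall>q\<in>U \<inter> X. dist (f p) (f q) < \<theta>)}"
  have "q \<in> \<Union> ?U" if "q \<in> C" for q
  proof -
    have "q \<in> X" using that \<open>C \<subseteq> X\<close> by blast
    then obtain d where "d > 0" and d: "\<forall>p\<in>X. dist p q < d \<longrightarrow> dist (f p) (f q) < \<theta> / 2"
      using cont \<open>\<theta> > 0\<close> unfolding continuous_on_iff by (meson half_gt_zero)
    have "dist (f p) (f p') < \<theta>" if "p \<in> ball q d \<inter> X" "p' \<in> ball q d \<inter> X" for p p'
      using that d dist_triangle_half_l by (metis IntD1 IntD2 dist_commute mem_ball)
    then have "ball q d \<in> ?U" by simp
    then show ?thesis using \<open>d > 0\<close> by (meson UnionI centre_in_ball)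
  qed
  then have "C \<subseteq> \<Union> ?U" by (rule subsetI)
  then obtain e where "e > 0" and e: "\<And>q. q \<in> C \<Longrightarrow> \<exists>U\<in>?U. ball q e \<subseteq> U"
    using Heine_Borel_lemma[OF \<open>compact C\<close>] by (metis (no_types, lifting) mem_Collect_eq)
  have "dist (f q) (f p) < \<theta>" if "q \<in> C" "p \<in> X" "dist q p < e" for q p
  proof -
    obtain U where U: "U \<in> ?U" "ball q e \<subseteq> U" using e \<open>q \<in> C\<close> by blast
    then have "q \<in> U \<inter> X" "p \<in> U \<inter> X"
      using that \<open>e > 0\<close> \<open>C \<subseteq> X\<close> by (auto simp: subset_iff)
    with U show ?thesis by blast
  qed
  with \<open>e > 0\<close> show ?thesis by blast
qed

lemma ifs_uniform_at_compact:
  assumes "ifs X m f" and "compact C" "C \<subseteq> X" and "\<theta> > 0"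
  shows "\<exists>\<gamma>>0. \<forall>i\<in>{1..m}. \<forall>q\<in>C. \<forall>p\<in>X. dist q p < \<gamma> \<longrightarrow> dist (f i q) (f i p) < \<theta>"
proof (rule finite_common_bound)
  show "\<exists>\<gamma>>0. \<forall>q\<in>C. \<forall>p\<in>X. dist q p < \<gamma> \<longrightarrow> dist (f i q) (f i p) < \<theta>"
    if "i \<in> {1..m}" for i
    using assms that by (intro continuous_on_uniform_at_compact) (auto simp: ifs_def)
qed (force)+

text \<open>The n-th points of all orbits from \<open>C\<close> lie in this iterate. Its compactness
  makes the uniform estimate available at every one of them at once.\<close>

lemma hutchinson_funpow_compact:
  assumes "ifs X m f" and "compact C" "C \<subseteq> X"
  shows "compact ((hutchinson m f ^^ n) C) \<and> (hutchinson m f ^^ n) C \<subseteq> X"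
proof (induction n)
  case (Suc n)
  let ?D = "(hutchinson m f ^^ n) C"
  have "compact (f i ` ?D) \<and> f i ` ?D \<subseteq> X" if "i \<in> {1..m}" for i
  proof -
    have "continuous_on X (f i)" "f i ` X \<subseteq> X"
      using assms(1) that by (auto simp: ifs_def)
    then show ?thesis
      using Suc by (blast intro: compact_continuous_image continuous_on_subset)
  qed
  then have "compact (\<Union>i\<in>{1..m}. f i ` ?D) \<and> (\<Union>i\<in>{1..m}. f i ` ?D) \<subseteq> X"
    by (intro conjI compact_UN UN_least) simp_all
  then show ?case
    by (simp add: hutchinson_def[of m f ?D])
qed (use assms in auto)

lemma word_map_in_hutchinson_funpow:
  assumes "I \<in> ifs_words m" and "x \<in> C"
  shows "word_map f I x \<in> (hutchinson m f ^^ length I) C"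
  using assms
proof (induction I rule: rev_induct)
  case (snoc i I)
  then have "word_map f I x \<in> (hutchinson m f ^^ length I) C" "i \<in> {1..m}"
    by (auto simp: ifs_words_def)
  then have "f i (word_map f I x) \<in> hutchinson m f ((hutchinson m f ^^ length I) C)"
    unfolding hutchinson_def[of m f "(hutchinson m f ^^ length I) C"] by blast
  then show ?case
    by (simp add: word_map_def)
qed (simp add: word_map_def)

section \<open>Chains of bounded length follow orbits\<close>

text \<open>Induction on the length. The new error is the image of the old error under one map plus
  the last jump. The first is below \<theta> / 2 if the old error is below the modulus \<gamma> at
  the compact set of n-th orbit points, so the induction hypothesis is used with \<gamma> in place
  of \<theta>. The bound obtained is independent of the starting point in \<open>C\<close>.\<close>

lemma chain_follows_orbit:
  assumes "ifs X m f" and "compact C" "C \<subseteq> X" and "\<theta> > 0"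
  shows "\<exists>\<epsilon>>0. \<forall>x\<in>C. \<forall>y. (x, y) \<in> chain_step X m f \<epsilon> ^^ n \<longrightarrow>
    (\<exists>I\<in>ifs_words m. length I = n \<and> dist (word_map f I x) y < \<theta>)"
  using \<open>\<theta> > 0\<close>
proof (induction n arbitrary: \<theta>)
  case 0
  then show ?case
    by (intro exI[of _ 1]) (auto simp: ifs_words_def word_map_def)
next
  case (Suc n)
  let ?D = "(hutchinson m f ^^ n) C"
  have "compact ?D" "?D \<subseteq> X" "\<theta> / 2 > 0"
    using hutchinson_funpow_compact[OF assms(1-3)] Suc.prems by auto
  then obtain \<gamma> where "\<gamma> > 0" and \<gamma>:
      "\<forall>i\<in>{1..m}. \<forall>q\<in>?D. \<forall>p\<in>X. dist q p < \<gamma> \<longrightarrow> dist (f i q) (f i p) < \<theta> / 2"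
    using ifs_uniform_at_compact[OF assms(1)] by meson
  obtain \<epsilon> where "\<epsilon> > 0" and \<epsilon>: "\<forall>x\<in>C. \<forall>y. (x, y) \<in> chain_step X m f \<epsilon> ^^ n \<longrightarrow>
      (\<exists>I\<in>ifs_words m. length I = n \<and> dist (word_map f I x) y < \<gamma>)"
    using Suc.IH[OF \<open>\<gamma> > 0\<close>] by blast
  \<comment> \<open>The first bound controls the initial \<open>n\<close> steps, the second the last
    jump.\<close>
  let ?\<epsilon> = "min \<epsilon> (\<theta> / 2)"
  have "\<exists>I\<in>ifs_words m. length I = Suc n \<and> dist (word_map f I x) y < \<theta>"
    if "x \<in> C" and xy: "(x, y) \<in> chain_step X m f ?\<epsilon> ^^ Suc n" for x y
  proof -
    from xy obtain z where xz: "(x, z) \<in> chain_step X m f ?\<epsilon> ^^ n"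
        and zy: "(z, y) \<in> chain_step X m f ?\<epsilon>"
      by auto
    have "(x, z) \<in> chain_step X m f \<epsilon> ^^ n"
      using xz relpow_mono_set[OF chain_step_mono[of ?\<epsilon> \<epsilon>]] by fastforce
    with \<epsilon> \<open>x \<in> C\<close> obtain I where I: "I \<in> ifs_words m" "length I = n"
        "dist (word_map f I x) z < \<gamma>"
      by blast
    from zy obtain i where i: "i \<in> {1..m}" "dist (f i z) y < \<theta> / 2" and "z \<in> X"
      by (auto simp: chain_step_def)
    have "word_map f I x \<in> ?D"
      using word_map_in_hutchinson_funpow[OF I(1) \<open>x \<in> C\<close>, where f = f] I(2) by simp
    then have "dist (f i (word_map f I x)) (f i z) < \<theta> / 2"
      by (rule \<gamma>[rule_format, OF i(1) _ \<open>z \<in> X\<close> I(3)])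
    with i have "dist (f i (word_map f I x)) y < \<theta>"
      using dist_triangle[of "f i (word_map f I x)" y "f i z"] by linarith
    with I i have "I @ [i] \<in> ifs_words m \<and> length (I @ [i]) = Suc n \<and>
        dist (word_map f (I @ [i]) x) y < \<theta>"
      by (auto simp: ifs_words_def word_map_def)
    then show ?thesis by blast
  qed
  with \<open>\<epsilon> > 0\<close> Suc.prems show ?case
    by (intro exI[of _ ?\<epsilon>]) auto
qed

lemma chain_follows_orbit_upto:
  assumes "ifs X m f" and "compact C" "C \<subseteq> X" and "\<theta> > 0"
  shows "\<exists>\<epsilon>>0. \<forall>n\<in>{..N}. \<forall>x\<in>C. \<forall>y. (x, y) \<in> chain_step X m f \<epsilon> ^^ n \<longrightarrow>
    (\<exists>I\<in>ifs_words m. length I = n \<and> dist (word_map f I x) y < \<theta>)"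
proof (rule finite_common_bound)
  fix n and e e' :: real
  assume "\<forall>x\<in>C. \<forall>y. (x, y) \<in> chain_step X m f e ^^ n \<longrightarrow>
    (\<exists>I\<in>ifs_words m. length I = n \<and> dist (word_map f I x) y < \<theta>)" "e' \<le> e"
  then show "\<forall>x\<in>C. \<forall>y. (x, y) \<in> chain_step X m f e' ^^ n \<longrightarrow>
    (\<exists>I\<in>ifs_words m. length I = n \<and> dist (word_map f I x) y < \<theta>)"
    using relpow_mono_set[OF chain_step_mono] by blast
qed (use chain_follows_orbit[OF assms] in auto)

text \<open>A Lebesgue number for the cover of \<open>G\<close> by one open set, whose trace on
  \<open>X\<close> is the relative interior of \<open>K\<close>.\<close>

lemma compact_nbhd_contains_uniform_nbhd:
  assumes "compact_nbhd X G K" and "compact G"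
  shows "\<exists>\<delta>>0. \<forall>y\<in>X. (\<exists>g\<in>G. dist g y < \<delta>) \<longrightarrow> y \<in> K"
proof -
  have "openin (top_of_set X) ((top_of_set X) interior_of K)" by simp
  then obtain U where U: "open U" "(top_of_set X) interior_of K = X \<inter> U"
    unfolding openin_open by blast
  have "G \<subseteq> U" using assms(1) U by (auto simp: compact_nbhd_def)
  then obtain \<delta> where "\<delta> > 0" and \<delta>: "\<And>g. g \<in> G \<Longrightarrow> ball g \<delta> \<subseteq> U"
    using Heine_Borel_lemma[OF \<open>compact G\<close>, of "{U}"] U(1) by auto
  have "y \<in> K" if "y \<in> X" "g \<in> G" "dist g y < \<delta>" for y g
    using \<delta>[OF \<open>g \<in> G\<close>] that U(2) interior_of_subset[of "top_of_set X" K] by (auto simp: subset_iff)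
  with \<open>\<delta> > 0\<close> show ?thesis by blast
qed

section \<open>Long chains stay near the attractor\<close>

lemma chain_eventually_near_attractor:
  assumes "ifs X m f" and attr: "global_attractor X m f G" and K: "compact_nbhd X G K"
    and "compact C" "C \<subseteq> X" and "\<eta> > 0"
  shows "\<exists>\<epsilon>>0. \<exists>\<tau>. \<forall>x\<in>C. \<forall>y. \<forall>n\<ge>\<tau>. (x, y) \<in> chain_step X m f \<epsilon> ^^ n \<longrightarrow>
    (\<exists>g\<in>G. dist g y < \<eta>)"
proof -
  have "compact G" using attr by (simp add: global_attractor_def)
  obtain \<delta> where "\<delta> > 0" and \<delta>: "\<forall>y\<in>X. (\<exists>g\<in>G. dist g y < \<delta>) \<longrightarrow> y \<in> K"
    using compact_nbhd_contains_uniform_nbhd[OF K \<open>compact G\<close>] by blast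
  \<comment> \<open>\<theta> \<le> \<delta> places points of \<open>X\<close> that are \<theta>-near
    \<open>G\<close> in \<open>K\<close>, where a chain can be restarted; \<theta> \<le> \<eta>
    gives the conclusion.\<close>
  define \<theta> where "\<theta> = min \<delta> \<eta>"
  have \<theta>: "\<theta> > 0" "\<theta> \<le> \<delta>" "\<theta> \<le> \<eta>"
    using \<open>\<delta> > 0\<close> \<open>\<eta> > 0\<close> by (auto simp: \<theta>_def)
  \<comment> \<open>The chain starts in \<open>C\<close> but restarts in \<open>K\<close>, so
    attraction and orbit following are required uniformly on both.\<close>
  let ?C = "C \<union> K"
  have C: "compact ?C" "?C \<subseteq> X"
    using K assms by (auto simp: compact_nbhd_def)
  then have "attracts X m f G ?C"
    using attr by (simp add: global_attractor_def)
  then obtain \<tau> :: nat where "\<tau> > 0" and \<tau>: "\<And>I. I \<in> ifs_words m \<Longrightarrow> length I \<ge> \<tau> \<Longrightarrow>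
      word_map f I ` ?C \<subseteq> eps_nbhd X (\<theta> / 2) G"
    using \<theta>(1) unfolding attracts_def by (metis half_gt_zero)
  obtain \<epsilon> where "\<epsilon> > 0" and \<epsilon>:
    "\<forall>n\<in>{..2 * \<tau>}. \<forall>x\<in>?C. \<forall>y. (x, y) \<in> chain_step X m f \<epsilon> ^^ n \<longrightarrow>
      (\<exists>I\<in>ifs_words m. length I = n \<and> dist (word_map f I x) y < \<theta> / 2)"
    using chain_follows_orbit_upto[OF assms(1) C, of "\<theta> / 2" "2 * \<tau>"] \<theta>(1) by auto
  let ?S = "chain_step X m f \<epsilon>"
  \<comment> \<open>One half of \<theta> is spent between the chain and the orbit, the other between
    the orbit and \<open>G\<close>.\<close>
  have window: "\<exists>g\<in>G. dist g y < \<theta>"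
    if xy: "x \<in> ?C" "(x, y) \<in> ?S ^^ n" and n: "\<tau> \<le> n" "n \<le> 2 * \<tau>" for x y n
  proof -
    obtain I where I: "I \<in> ifs_words m" "length I = n" "dist (word_map f I x) y < \<theta> / 2"
      using \<epsilon> xy n by (meson atMost_iff)
    then have "word_map f I x \<in> eps_nbhd X (\<theta> / 2) G"
      using \<tau> xy n by blast
    then have "G \<noteq> {}" "infdist (word_map f I x) G < \<theta> / 2"
      by (auto simp: eps_nbhd_def)
    \<comment> \<open>Rewriting \<open>infdist\<close> as an infimum over the nonempty set
      \<open>G\<close> yields an actual point of \<open>G\<close> at distance below \<theta> /
      2.\<close>
    then have "(INF g\<in>G. dist (word_map f I x) g) < \<theta> / 2"
      by (simp add: infdist_notempty)
    moreover have "bdd_below (dist (word_map f I x) ` G)"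
      by (intro bdd_belowI2[of _ 0]) simp
    ultimately obtain g where "g \<in> G" "dist (word_map f I x) g < \<theta> / 2"
      using cINF_less_iff[OF \<open>G \<noteq> {}\<close>] by blast
    with I show ?thesis
      using dist_triangle[of g y "word_map f I x"]
      by (intro bexI[of _ g]) (auto simp: dist_commute)
  qed
  have "\<exists>g\<in>G. dist g y < \<theta>" if "x \<in> ?C" "(x, y) \<in> ?S ^^ n" "\<tau> \<le> n" for x y n
    using that
  proof (induction n arbitrary: x rule: less_induct)
    case (less n)
    show ?case
    proof (cases "n \<le> 2 * \<tau>")
      case True
      then show ?thesis using window less.prems by blast
    next
      case False
      \<comment> \<open>Cutting off the first \<tau> steps leaves more than \<tau> steps, so the
        induction hypothesis applies from the cut point \<open>z\<close> once \<open>z\<close> lies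
        in \<open>K\<close>. The remainder is strictly shorter because \<tau> > 0.\<close>
      then have "n = \<tau> + (n - \<tau>)" by simp
      with less.prems have "(x, y) \<in> ?S ^^ \<tau> O ?S ^^ (n - \<tau>)"
        by (metis relpow_add)
      then obtain z where z: "(x, z) \<in> ?S ^^ \<tau>" "(z, y) \<in> ?S ^^ (n - \<tau>)"
        by blast
      have "z \<in> X"
        using z(1) \<open>\<tau> > 0\<close> by (cases \<tau>) (auto simp: chain_step_def)
      moreover have "\<exists>g\<in>G. dist g z < \<theta>"
        using window[OF less.prems(1) z(1)] by simp
      ultimately have "z \<in> ?C"
        using \<delta> \<theta>(2) by (metis UnI2 order_less_le_trans)
      then show ?thesis
        using less.IH[of "n - \<tau>" z] z(2) False \<open>\<tau> > 0\<close> by auto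
    qed
  qed
  then have "\<forall>x\<in>C. \<forall>y. \<forall>n\<ge>\<tau>. (x, y) \<in> ?S ^^ n \<longrightarrow> (\<exists>g\<in>G. dist g y < \<eta>)"
    using \<theta>(3) by (meson UnI1 order_less_le_trans)
  with \<open>\<epsilon> > 0\<close> show ?thesis by blast
qed

lemma hutchinson_invariant_image:
  "hutchinson m f G = G \<Longrightarrow> i \<in> {1..m} \<Longrightarrow> x \<in> G \<Longrightarrow> f i x \<in> G"
  unfolding hutchinson_def by blast

lemma word_map_invariant:
  assumes "hutchinson m f G = G" and "I \<in> ifs_words m" and "x \<in> G"
  shows "word_map f I x \<in> G"
proof -
  have "(hutchinson m f ^^ n) G = G" for n
    by (induction n) (use assms(1) in auto)
  then show ?thesis
    using word_map_in_hutchinson_funpow[OF assms(2,3)] by metis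
qed

text \<open>Times from \<tau> on are covered by the previous estimate. Before \<tau> the chain
  follows an orbit starting in \<open>G\<close>, which remains in \<open>G\<close> by
  invariance.\<close>

lemma chain_near_attractor:
  assumes "ifs X m f" and attr: "global_attractor X m f G" and K: "compact_nbhd X G K"
    and "\<eta> > 0"
  shows "\<exists>\<epsilon>>0. \<forall>x\<in>G. \<forall>y. (x, y) \<in> (chain_step X m f \<epsilon>)\<^sup>* \<longrightarrow> (\<exists>g\<in>G. dist g y < \<eta>)"
proof -
  have G: "compact G" "G \<subseteq> X" "hutchinson m f G = G"
    using attr by (auto simp: global_attractor_def)
  obtain \<epsilon>\<^sub>1 \<tau> where "\<epsilon>\<^sub>1 > 0" and late: "\<forall>x\<in>G. \<forall>y. \<forall>n\<ge>\<tau>.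
      (x, y) \<in> chain_step X m f \<epsilon>\<^sub>1 ^^ n \<longrightarrow> (\<exists>g\<in>G. dist g y < \<eta>)"
    using chain_eventually_near_attractor[OF assms(1-3) G(1,2) \<open>\<eta> > 0\<close>] by blast
  obtain \<epsilon>\<^sub>2 where "\<epsilon>\<^sub>2 > 0" and early: "\<forall>n\<in>{..\<tau>}. \<forall>x\<in>G. \<forall>y.
      (x, y) \<in> chain_step X m f \<epsilon>\<^sub>2 ^^ n \<longrightarrow>
      (\<exists>I\<in>ifs_words m. length I = n \<and> dist (word_map f I x) y < \<eta>)"
    using chain_follows_orbit_upto[OF assms(1) G(1,2) \<open>\<eta> > 0\<close>] by blast
  let ?\<epsilon> = "min \<epsilon>\<^sub>1 \<epsilon>\<^sub>2"
  have "\<exists>g\<in>G. dist g y < \<eta>"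
    if "x \<in> G" and xy: "(x, y) \<in> (chain_step X m f ?\<epsilon>)\<^sup>*" for x y
  proof -
    obtain n where "(x, y) \<in> chain_step X m f ?\<epsilon> ^^ n"
      using xy rtrancl_imp_relpow by blast
    then have n: "(x, y) \<in> chain_step X m f \<epsilon>\<^sub>1 ^^ n" "(x, y) \<in> chain_step X m f \<epsilon>\<^sub>2 ^^ n"
      using relpow_mono_set[OF chain_step_mono, of ?\<epsilon>] by (meson min.cobounded1 min.cobounded2 subsetD)+
    show ?thesis
    proof (cases "\<tau> \<le> n")
      case True
      then show ?thesis using late n \<open>x \<in> G\<close> by blast
    next
      case False
      then obtain I where "I \<in> ifs_words m" "dist (word_map f I x) y < \<eta>"
        using early n \<open>x \<in> G\<close> by (meson atMost_iff nat_le_linear)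
      then show ?thesis
        using word_map_invariant[OF G(3)] \<open>x \<in> G\<close> by blast
    qed
  qed
  with \<open>\<epsilon>\<^sub>1 > 0\<close> \<open>\<epsilon>\<^sub>2 > 0\<close> show ?thesis
    by (intro exI[of _ ?\<epsilon>]) auto
qed

section \<open>Moving chains into the attractor\<close>

lemma chain_step_restrict:
  "chain_step G m (ifs_restrict G f) \<epsilon> = chain_step G m f \<epsilon>"
  by (auto simp: chain_step_def ifs_restrict_def)

text \<open>Each chain point is replaced by an \<eta>-near point of \<open>G\<close>. A step between
  new points has three errors, each below \<epsilon> / 3: the displacement of the source after
  applying the map, the original jump, and the displacement of the target.\<close>

lemma chain_moved_into_attractor:
  assumes "ifs X m f" and attr: "global_attractor X m f G" and K: "compact_nbhd X G K"
    and "\<epsilon> > 0"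
  shows "\<exists>\<epsilon>'>0. \<forall>x\<in>G. \<forall>y\<in>G. (x, y) \<in> (chain_step X m f \<epsilon>')\<^sup>* \<longrightarrow>
    (x, y) \<in> (chain_step G m f \<epsilon>)\<^sup>*"
proof -
  have G: "compact G" "G \<subseteq> X"
    using attr by (auto simp: global_attractor_def)
  obtain \<gamma> where "\<gamma> > 0" and \<gamma>:
      "\<forall>i\<in>{1..m}. \<forall>q\<in>G. \<forall>p\<in>X. dist q p < \<gamma> \<longrightarrow> dist (f i q) (f i p) < \<epsilon> / 3"
    using ifs_uniform_at_compact[OF assms(1) G, of "\<epsilon> / 3"] \<open>\<epsilon> > 0\<close> by auto
  \<comment> \<open>\<gamma> bounds the effect of moving the source, \<epsilon> / 3 that of moving
    the target.\<close>
  define \<eta> where "\<eta> = min \<gamma> (\<epsilon> / 3)"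
  have "\<eta> > 0" using \<open>\<gamma> > 0\<close> \<open>\<epsilon> > 0\<close> by (simp add: \<eta>_def)
  obtain \<epsilon>\<^sub>1 where "\<epsilon>\<^sub>1 > 0" and near: "\<forall>x\<in>G. \<forall>y. (x, y) \<in> (chain_step X m f \<epsilon>\<^sub>1)\<^sup>* \<longrightarrow>
      (\<exists>g\<in>G. dist g y < \<eta>)"
    using chain_near_attractor[OF assms(1-3) \<open>\<eta> > 0\<close>] by blast
  define \<epsilon>' where "\<epsilon>' = min \<epsilon>\<^sub>1 (\<epsilon> / 3)"
  let ?S = "chain_step X m f \<epsilon>'" and ?T = "chain_step G m f \<epsilon>"
  have move: "(w', z') \<in> ?T"
    if wz: "(w, z) \<in> ?S" and that: "w' \<in> G" "z' \<in> G" "dist w' w < \<eta>" "dist z' z < \<eta>" for w z w' z'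
  proof -
    obtain i where i: "i \<in> {1..m}" "dist (f i w) z < \<epsilon>'" and "w \<in> X"
      using wz unfolding chain_step_def by blast
    then have "dist (f i w) z < \<epsilon> / 3" by (simp add: \<epsilon>'_def)
    moreover have "dist (f i w') (f i w) < \<epsilon> / 3"
      using \<gamma> i that \<open>w \<in> X\<close> by (auto simp: \<eta>_def)
    moreover have "dist z z' < \<epsilon> / 3"
      using that(4) by (auto simp: \<eta>_def dist_commute)
    ultimately have "dist (f i w') z' < \<epsilon>"
      using dist_triangle[of "f i w'" z' "f i w"] dist_triangle[of "f i w" z' z] by linarith
    with i that show ?thesis by (auto simp: chain_step_def)
  qed
  have near': "\<exists>g\<in>G. dist g y < \<eta>" if "x \<in> G" "(x, y) \<in> ?S\<^sup>*" for x y
  proof -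
    have "?S\<^sup>* \<subseteq> (chain_step X m f \<epsilon>\<^sub>1)\<^sup>*"
      by (intro rtrancl_mono chain_step_mono) (simp add: \<epsilon>'_def)
    with near that show ?thesis by blast
  qed
  have moved: "\<exists>y'\<in>G. dist y' y < \<eta> \<and> (x, y') \<in> ?T\<^sup>*" if "(x, y) \<in> ?S\<^sup>*" "x \<in> G" for x y
    using that
  proof (induction rule: rtrancl_induct)
    case base
    then show ?case using \<open>\<eta> > 0\<close> by (intro bexI[of _ x]) auto
  next
    case (step y z)
    then obtain y' where y': "y' \<in> G" "dist y' y < \<eta>" "(x, y') \<in> ?T\<^sup>*"
      by blast
    have "(x, z) \<in> ?S\<^sup>*" using step by simp
    then obtain z' where z': "z' \<in> G" "dist z' z < \<eta>"
      using near' step.prems by blast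
    show ?case
      using move[OF step.hyps(2) y'(1) z'(1) y'(2) z'(2)] y'(3) z' by (meson rtrancl.rtrancl_into_rtrancl)
  qed
  \<comment> \<open>The invariant \<open>moved\<close> reaches only some point near the end of the
    chain. The last step is therefore moved separately, with its target \<open>y\<close>, already in
    \<open>G\<close>, left in place.\<close>
  have "(x, y) \<in> ?T\<^sup>*" if "x \<in> G" "y \<in> G" "(x, y) \<in> ?S\<^sup>*" for x y
    using that(3)
  proof (cases rule: rtranclE)
    case base
    then show ?thesis by simp
  next
    case (step w)
    then obtain w' where w': "w' \<in> G" "dist w' w < \<eta>" "(x, w') \<in> ?T\<^sup>*"
      using moved \<open>x \<in> G\<close> by blast
    then have "(w', y) \<in> ?T"
      using move[OF step(2)] \<open>y \<in> G\<close> \<open>\<eta> > 0\<close> by simp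
    with w' show ?thesis by (meson rtrancl.rtrancl_into_rtrancl)
  qed
  moreover have "\<epsilon>' > 0" using \<open>\<epsilon>\<^sub>1 > 0\<close> \<open>\<epsilon> > 0\<close> by (simp add: \<epsilon>'_def)
  ultimately show ?thesis by blast
qed

lemma chain_relation_restrict:
  assumes "ifs X m f" and attr: "global_attractor X m f G" and K: "compact_nbhd X G K"
  shows "chain_relation X m f \<inter> (G \<times> G) = chain_relation G m (ifs_restrict G f)"
proof (intro equalityI subrelI)
  fix x y
  assume "(x, y) \<in> chain_relation X m f \<inter> (G \<times> G)"
  then have "x \<in> G" "y \<in> G" "\<forall>\<epsilon>>0. (x, y) \<in> (chain_step X m f \<epsilon>)\<^sup>*"
    by (auto simp: chain_relation_iff)
  then have "(x, y) \<in> (chain_step G m f \<epsilon>)\<^sup>*" if "\<epsilon> > 0" for \<epsilon>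
    using chain_moved_into_attractor[OF assms that] by blast
  with \<open>x \<in> G\<close> show "(x, y) \<in> chain_relation G m (ifs_restrict G f)"
    by (simp add: chain_relation_iff chain_step_restrict)
next
  fix x y
  assume "(x, y) \<in> chain_relation G m (ifs_restrict G f)"
  then have "x \<in> G" and *: "\<forall>\<epsilon>>0. (x, y) \<in> (chain_step G m f \<epsilon>)\<^sup>*"
    by (auto simp: chain_relation_iff chain_step_restrict)
  have "G \<subseteq> X" using attr by (simp add: global_attractor_def)
  then have "(chain_step G m f \<epsilon>)\<^sup>* \<subseteq> (chain_step X m f \<epsilon>)\<^sup>*" for \<epsilon>
    by (intro rtrancl_mono) (auto simp: chain_step_def)
  with * have "\<forall>\<epsilon>>0. (x, y) \<in> (chain_step X m f \<epsilon>)\<^sup>*" by blast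
  \<comment> \<open>A chain in \<open>G\<close> for \<epsilon> = 1 is either empty, so that y = x,
    or its last step ends in \<open>G\<close>.\<close>
  moreover have "y \<in> G"
    using *[rule_format, of 1] \<open>x \<in> G\<close> by (auto elim!: rtranclE simp: chain_step_def)
  ultimately show "(x, y) \<in> chain_relation X m f \<inter> (G \<times> G)"
    using \<open>x \<in> G\<close> \<open>G \<subseteq> X\<close> by (auto simp: chain_relation_iff)
qed

section \<open>Recurrent points lie in the attractor\<close>

text \<open>A closed path of positive length can be traversed repeatedly, each round adding at least
  one step.\<close>

lemma long_closed_chain:
  assumes "(x, x) \<in> R\<^sup>+"
  shows "\<exists>n\<ge>N. (x, x) \<in> R ^^ n"
proof (induction N)
  case 0
  then show ?case by (auto intro: exI[of _ 0])
next
  case (Suc N)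
  then obtain n where n: "n \<ge> N" "(x, x) \<in> R ^^ n" by blast
  from assms obtain k where k: "k > 0" "(x, x) \<in> R ^^ k"
    by (auto simp: trancl_power)
  from n k have "(x, x) \<in> R ^^ (n + k)"
    by (auto simp: relpow_add)
  then show ?case
    using n(1) k(1) by (intro exI[of _ "n + k"]) auto
qed

text \<open>The exact step from \<open>x\<close> to \<open>f i x\<close> followed by a chain back
  closes up with positive length. Repeating it gives arbitrarily long chains from the compact set
  \<open>{x}\<close> to \<open>x\<close>, so \<open>x\<close> is within every \<eta> of the closed
  set \<open>G\<close>.\<close>

lemma chain_recurrent_subset_attractor:
  assumes "ifs X m f" and attr: "global_attractor X m f G" and K: "compact_nbhd X G K"
  shows "chain_recurrent_set X m f \<subseteq> G"
proof
  fix x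
  assume "x \<in> chain_recurrent_set X m f"
  then obtain i where i: "i \<in> {1..m}" "x \<in> X" "(f i x, x) \<in> chain_relation X m f"
    by (auto simp: chain_recurrent_set_def chain_equivalent_def)
  have closed_chain: "(x, x) \<in> (chain_step X m f \<epsilon>)\<^sup>+" if "\<epsilon> > 0" for \<epsilon>
  proof -
    have "f i x \<in> X"
      using i assms(1) unfolding ifs_def by blast
    then have "(x, f i x) \<in> chain_step X m f \<epsilon>"
      using i that by (auto simp: chain_step_def intro!: bexI[of _ i])
    moreover have "(f i x, x) \<in> (chain_step X m f \<epsilon>)\<^sup>*"
      using i that by (simp add: chain_relation_iff)
    ultimately show ?thesis by simp
  qed
  have "\<exists>g\<in>G. dist g x < \<eta>" if "\<eta> > 0" for \<eta>
  proof -
    obtain \<epsilon> \<tau> where "\<epsilon> > 0" and late: "\<forall>x'\<in>{x}. \<forall>y. \<forall>n\<ge>\<tau>.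
        (x', y) \<in> chain_step X m f \<epsilon> ^^ n \<longrightarrow> (\<exists>g\<in>G. dist g y < \<eta>)"
      using chain_eventually_near_attractor[OF assms _ _ \<open>\<eta> > 0\<close>, of "{x}"] i(2) by auto
    then show ?thesis
      using long_closed_chain[OF closed_chain[OF \<open>\<epsilon> > 0\<close>], of \<tau>] by blast
  qed
  then have "x \<in> closure G" by (simp add: closure_approachable)
  moreover have "closed G" using attr by (simp add: global_attractor_def compact_imp_closed)
  ultimately show "x \<in> G" by simp
qed

lemma orbitwise_chain_recurrent_subset:
  assumes "ifs X m f"
  shows "orbitwise_chain_recurrent_set X m f \<subseteq> chain_recurrent_set X m f"
proof -
  have "1 \<in> {1..m}" using assms by (simp add: ifs_def)
  moreover have "f 1 x \<in> ifs_orbit m f x" for x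
    using \<open>1 \<in> {1..m}\<close> by (auto simp: ifs_orbit_def ifs_words_def word_map_def intro!: image_eqI[of _ _ "[1]"])
  ultimately show ?thesis
    unfolding orbitwise_chain_recurrent_set_def chain_recurrent_set_def by blast
qed

section \<open>Orbits, nodes and edges of the restricted system\<close>

text \<open>Orbits from \<open>G\<close> never leave \<open>G\<close>, so the undefined values of
  the restricted maps are never met.\<close>

lemma ifs_orbit_restrict:
  assumes inv: "hutchinson m f G = G" and "x \<in> G"
  shows "ifs_orbit m (ifs_restrict G f) x = ifs_orbit m f x"
proof -
  have "word_map (ifs_restrict G f) I x = word_map f I x" if "I \<in> ifs_words m" for I
    using that
  proof (induction I rule: rev_induct)
    case (snoc i I)
    then have "I \<in> ifs_words m" by (simp add: ifs_words_def)
    with snoc.IH word_map_invariant[OF inv _ \<open>x \<in> G\<close>, of I] show ?case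
      by (simp add: word_map_def ifs_restrict_def)
  qed (simp add: word_map_def)
  then show ?thesis
    by (simp add: ifs_orbit_def)
qed

lemma chain_equivalent_restrict:
  assumes "chain_relation X m f \<inter> (G \<times> G) = chain_relation G m f'" and "x \<in> G" "y \<in> G"
  shows "chain_equivalent G m f' x y \<longleftrightarrow> chain_equivalent X m f x y"
  using assms by (auto simp: chain_equivalent_def)

lemma chain_classes_restrict:
  assumes "chain_relation X m f \<inter> (G \<times> G) = chain_relation G m f'" and "R \<subseteq> G"
  shows "chain_classes G m f' R = chain_classes X m f R"
proof -
  have "{(x, y). x \<in> R \<and> y \<in> R \<and> chain_equivalent G m f' x y}
      = {(x, y). x \<in> R \<and> y \<in> R \<and> chain_equivalent X m f x y}"
    using chain_equivalent_restrict[OF assms(1)] assms(2) by blast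
  then show ?thesis by (simp add: chain_classes_def)
qed

lemma chain_classes_subset: "N \<in> chain_classes X m f R \<Longrightarrow> N \<subseteq> R"
  by (auto simp: chain_classes_def quotient_def)

text \<open>Edges test the chain relation only between members of vertices, all of which lie in
  \<open>G\<close>.\<close>

lemma chain_edges_restrict:
  assumes "chain_relation X m f \<inter> (G \<times> G) = chain_relation G m f'" and "\<And>N. N \<in> V \<Longrightarrow> N \<subseteq> G"
  shows "chain_edges G m f' V = chain_edges X m f V"
proof -
  have "(x, y) \<in> chain_relation G m f' \<longleftrightarrow> (x, y) \<in> chain_relation X m f"
    if "N\<^sub>1 \<in> V" "N\<^sub>2 \<in> V" "x \<in> N\<^sub>1" "y \<in> N\<^sub>2" for N\<^sub>1 N\<^sub>2 x y
    using assms that by blast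
  then show ?thesis
    unfolding chain_edges_def by blast
qed

theorem theorem11:
  fixes X G :: "'a::metric_space set" and m :: nat and f :: "nat \<Rightarrow> 'a \<Rightarrow> 'a"
  assumes "ifs X m f"
    and "global_attractor X m f G"
    and "\<exists>K. compact_nbhd X G K"
  shows "chain_relation X m f \<inter> (G \<times> G) = chain_relation G m (ifs_restrict G f)
    \<and> chain_recurrent_set X m f = chain_recurrent_set G m (ifs_restrict G f)
    \<and> chain_nodes X m f = chain_nodes G m (ifs_restrict G f)
    \<and> chain_graph X m f = chain_graph G m (ifs_restrict G f)
    \<and> orbitwise_chain_recurrent_set X m f = orbitwise_chain_recurrent_set G m (ifs_restrict G f)
    \<and> orbitwise_chain_nodes X m f = orbitwise_chain_nodes G m (ifs_restrict G f)
    \<and> orbitwise_chain_graph X m f = orbitwise_chain_graph G m (ifs_restrict G f)"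
proof -
  let ?g = "ifs_restrict G f"
  obtain K where K: "compact_nbhd X G K" using assms(3) by blast
  have inv: "hutchinson m f G = G" and "G \<subseteq> X"
    using assms(2) by (auto simp: global_attractor_def)
  have rel: "chain_relation X m f \<inter> (G \<times> G) = chain_relation G m ?g"
    by (rule chain_relation_restrict[OF assms(1,2) K])
  note equiv = chain_equivalent_restrict[OF rel]
  \<comment> \<open>\<open>rel\<close> compares the relations on pairs from \<open>G\<close> only;
    this inclusion and \<open>osub\<close> exclude recurrent points elsewhere.\<close>
  have sub: "chain_recurrent_set X m f \<subseteq> G"
    by (rule chain_recurrent_subset_attractor[OF assms(1,2) K])
  then have osub: "orbitwise_chain_recurrent_set X m f \<subseteq> G"
    using orbitwise_chain_recurrent_subset[OF assms(1)] by blast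
  \<comment> \<open>Invariance puts \<open>f i x\<close> in \<open>G\<close>, so
    \<open>equiv\<close> applies to this pair.\<close>
  have "chain_equivalent G m ?g x (?g i x) \<longleftrightarrow> chain_equivalent X m f x (f i x)"
    if "x \<in> G" "i \<in> {1..m}" for x i
    using equiv[OF that(1), of "f i x"] hutchinson_invariant_image[OF inv that(2,1)] that(1)
    by (simp add: ifs_restrict_def)
  then have rec: "chain_recurrent_set X m f = chain_recurrent_set G m ?g"
    using sub \<open>G \<subseteq> X\<close> unfolding chain_recurrent_set_def by blast
  have "(\<forall>y\<in>ifs_orbit m ?g x. chain_equivalent G m ?g x y) \<longleftrightarrow>
      (\<forall>y\<in>ifs_orbit m f x. chain_equivalent X m f x y)" if "x \<in> G" for x
  proof -
    have "ifs_orbit m f x \<subseteq> G"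
      using word_map_invariant[OF inv _ that] by (auto simp: ifs_orbit_def)
    then show ?thesis
      using equiv[OF that] ifs_orbit_restrict[OF inv that] by auto
  qed
  then have orec: "orbitwise_chain_recurrent_set X m f = orbitwise_chain_recurrent_set G m ?g"
    using osub \<open>G \<subseteq> X\<close> unfolding orbitwise_chain_recurrent_set_def by blast
  have nodes: "chain_nodes X m f = chain_nodes G m ?g"
    using chain_classes_restrict[OF rel sub] rec by (simp add: chain_nodes_def)
  have onodes: "orbitwise_chain_nodes X m f = orbitwise_chain_nodes G m ?g"
    using chain_classes_restrict[OF rel osub] orec by (simp add: orbitwise_chain_nodes_def)
  have "chain_edges G m ?g (chain_nodes X m f) = chain_edges X m f (chain_nodes X m f)"
    using chain_classes_subset sub unfolding chain_nodes_def
    by (intro chain_edges_restrict[OF rel]) blast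
  moreover have "chain_edges G m ?g (orbitwise_chain_nodes X m f)
      = chain_edges X m f (orbitwise_chain_nodes X m f)"
    using chain_classes_subset osub unfolding orbitwise_chain_nodes_def
    by (intro chain_edges_restrict[OF rel]) blast
  ultimately show ?thesis
    using rel rec orec nodes onodes by (simp add: chain_graph_def orbitwise_chain_graph_def)
qed

end
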